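(* For every sequent $\Gamma\Rightarrow\Delta$: if $\Gamma\Rightarrow\Delta$ is provable in $\mathsf{Go}_\infty+\mathsf{cut}$, then $\Gamma\Rightarrow\Delta$ is provable in $\mathsf{Go}_\infty$.
   Context: Formulas are given by $A ::= \bot \mid p \mid (A\to A)\mid \Box A$, where $p$ ranges over atomic propositions. A sequent is an expression $\Gamma\Rightarrow\Delta$ where $\Gamma,\Delta$ are finite multisets of formulas (commas denote multiset union). For a multiset $\Pi=A_1,\dots,A_n$ put $\Box\Pi:=\Box A_1,\dots,\Box A_n$ and $\boxtimes\Pi:=A_1,\dots,A_n,\Box A_1,\dots,\Box A_n$. The system $\mathsf{Go}_\infty$ has initial sequents $\Gamma,p\Rightarrow p,\Delta$ ($p$ an atomic proposition) and $\Gamma,\bot\Rightarrow\Delta$, and the rules: ($\to_L$) from $\Gamma,B\Rightarrow\Delta$ and $\Gamma\Rightarrow A,\Delta$ infer $\Gamma,A\to B\Rightarrow\Delta$; ($\to_R$) from $\Gamma,A\Rightarrow B,\Delta$ infer $\Gamma\Rightarrow A\to B,\Delta$; ($\Box$) (for $n\ge 1$) from the leftmost premise $\boxtimes\Pi\Rightarrow\boxtimes(A_1,\dots,A_n)$ and the $n$ premises $\boxtimes\Pi\Rightarrow A_1$, ..., $\boxtimes\Pi\Rightarrow A_n$ infer $\Gamma,\Box\Pi\Rightarrow\Box A_1,\dots,\Box A_n,\Delta$. All premises of ($\Box$) except the leftmost one are called right premises. The system $\mathsf{Go}_\infty+\mathsf{cut}$ additionally has the rule ($\mathsf{cut}$):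 from $\Gamma\Rightarrow A,\Delta$ and $\Gamma,A\Rightarrow\Delta$ infer $\Gamma\Rightarrow\Delta$. An $\infty$-proof in one of these systems is a possibly infinite tree whose nodes are marked by sequents, whose leaves are marked by initial sequents, which is built according to the rules of the system, and in which every infinite branch passes through a right premise of the rule ($\Box$) infinitely many times. A sequent is provable in the system if there is an $\infty$-proof in that system whose root is marked by that sequent. *)

theory Defs
  imports Main "HOL-Library.Multiset"
begin

datatype 'p fm =
    Bot
  | Atom 'p
  | Imp "'p fm" "'p fm"
  | Box "'p fm"

datatype 'p sequent = Sequent "'p fm multiset" "'p fm multiset"  (infix "\<turnstile>" 50)

definition boxes :: "'p fm multiset \<Rightarrow> 'p fm multiset" where
  "boxes \<Pi> = image_mset Box \<Pi>"

definition boxtimes :: "'p fm multiset \<Rightarrow> 'p fm multiset" where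
  "boxtimes \<Pi> = \<Pi> + boxes \<Pi>"

text \<open>A rule system is a relation between a conclusion and the list of its premises; initial
  sequents are the rules without premises. In an application of the modal rule the leftmost premise
  has position 0 and the right premises are exactly those at positions 1 to n.\<close>

inductive box_rule :: "'p sequent \<Rightarrow> 'p sequent list \<Rightarrow> bool" where
  "As \<noteq> [] \<Longrightarrow>
   box_rule (\<Gamma> + boxes \<Pi> \<turnstile> boxes (mset As) + \<Delta>)
     ((boxtimes \<Pi> \<turnstile> boxtimes (mset As)) # map (\<lambda>A. boxtimes \<Pi> \<turnstile> {#A#}) As)"

inductive Go_rule :: "'p sequent \<Rightarrow> 'p sequent list \<Rightarrow> bool" where
  Init_Atom: "Go_rule (\<Gamma> + {#Atom p#} \<turnstile> {#Atom p#} + \<Delta>) []"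
| Init_Bot: "Go_rule (\<Gamma> + {#Bot#} \<turnstile> \<Delta>) []"
| Imp_L: "Go_rule (\<Gamma> + {#Imp A B#} \<turnstile> \<Delta>) [\<Gamma> + {#B#} \<turnstile> \<Delta>, \<Gamma> \<turnstile> {#A#} + \<Delta>]"
| Imp_R: "Go_rule (\<Gamma> \<turnstile> {#Imp A B#} + \<Delta>) [\<Gamma> + {#A#} \<turnstile> {#B#} + \<Delta>]"
| Box_R: "box_rule s ps \<Longrightarrow> Go_rule s ps"

inductive Go_cut_rule :: "'p sequent \<Rightarrow> 'p sequent list \<Rightarrow> bool" where
  Go: "Go_rule s ps \<Longrightarrow> Go_cut_rule s ps"
| Cut: "Go_cut_rule (\<Gamma> \<turnstile> \<Delta>) [\<Gamma> \<turnstile> {#A#} + \<Delta>, \<Gamma> + {#A#} \<turnstile> \<Delta>]"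

text \<open>Nodes of a tree carry only sequents, not the names of rules. Nothing is lost as far as right
  premises are concerned, because an application of the modal rule is never also one of another
  rule: the initial sequents and the right implication rule have fewer than two premises, and the
  remaining rules are excluded by the following facts.\<close>

lemma not_box_rule_Imp_L: "\<not> box_rule s [\<Gamma> + {#B#} \<turnstile> \<Delta>, \<Gamma> \<turnstile> {#A#} + \<Delta>]"
  by (auto simp: box_rule.simps boxtimes_def boxes_def Cons_eq_map_conv)

lemma not_box_rule_Cut: "\<not> box_rule s [\<Gamma> \<turnstile> {#A#} + \<Delta>, \<Gamma> + {#A#} \<turnstile> \<Delta>]"
  by (auto simp: box_rule.simps Cons_eq_map_conv)

codatatype 'p tree = Node (root: "'p sequent") (subtrees: "'p tree list")

coinductive built_by :: "('p sequent \<Rightarrow> 'p sequent list \<Rightarrow> bool) \<Rightarrow> 'p tree \<Rightarrow> bool"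
  for R where
  "R (root t) (map root (subtrees t)) \<Longrightarrow> (\<forall>u \<in> set (subtrees t). built_by R u) \<Longrightarrow> built_by R t"

text \<open>The branch visits the subtrees \<open>b 0, b 1, \<dots>\<close>, moving at step \<open>i\<close> to the premise at
  position \<open>k i\<close>.\<close>

definition infinite_branch :: "'p tree \<Rightarrow> (nat \<Rightarrow> 'p tree) \<Rightarrow> (nat \<Rightarrow> nat) \<Rightarrow> bool" where
  "infinite_branch t b k \<longleftrightarrow>
     b 0 = t \<and>
     (\<forall>i. k i < length (subtrees (b i)) \<and> b (Suc i) = subtrees (b i) ! k i)"

definition right_premise :: "'p tree \<Rightarrow> nat \<Rightarrow> bool" where
  "right_premise t j \<longleftrightarrow>
     box_rule (root t) (map root (subtrees t)) \<and> 1 \<le> j \<and> j < length (subtrees t)"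

definition infinity_proof :: "('p sequent \<Rightarrow> 'p sequent list \<Rightarrow> bool) \<Rightarrow> 'p tree \<Rightarrow> bool" where
  "infinity_proof R t \<longleftrightarrow>
     built_by R t \<and>
     (\<forall>b k. infinite_branch t b k \<longrightarrow> infinite {i. right_premise (b i) (k i)})"

definition provable :: "('p sequent \<Rightarrow> 'p sequent list \<Rightarrow> bool) \<Rightarrow> 'p sequent \<Rightarrow> bool" where
  "provable R s \<longleftrightarrow> (\<exists>t. infinity_proof R t \<and> root t = s)"

end

theory Submission imports Defs begin

text \<open>Cut is admissible because both systems prove exactly the sequents that are valid in the same
  class of Kripke models. Their accessibility relation is transitive and antisymmetric, may be
  reflexive at some worlds and irreflexive at others, and has no infinite path through ever new
  worlds. Finite trees whose nodes carry a reflexivity flag are enough, and for them the size of the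
  tree decreases along the strict part of the relation.

  \<^bold>\<open>Soundness, with cut.\<close> If a world refutes the conclusion of a rule other than \<open>(\<box>)\<close>, it refutes
  some premise. If \<open>w\<close> refutes the conclusion of \<open>(\<box>)\<close>, then each \<open>A\<^sub>i\<close> fails at some world that \<open>w\<close>
  sees. Either one of these worlds is strictly above \<open>w\<close>, and it refutes a right premise, or \<open>w\<close> sees
  itself and all \<open>A\<^sub>i\<close> fail at \<open>w\<close>, and \<open>w\<close> refutes the leftmost premise. A refuted root of an
  \<open>\<infinity>\<close>-proof therefore starts a branch of refuted sequents along which the world moves strictly
  upwards at each right premise, so infinitely often; this is impossible (\<open>provable_cut_valid\<close>).

  \<^bold>\<open>Completeness, without cut.\<close> An \<open>\<infinity>\<close>-proof of a valid sequent can be assembled from fragments of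
  finite height that stop at right premises, as long as all these right premises are again valid.
  It is enough that every valid sequent has such a fragment. If a sequent has none, then a search
  backwards through the implication rules gives a saturated pair of sets of formulas, to be realised
  by a world. A right premise that is not valid has a countermodel, which can be hung above that
  world. The remaining boxed formulas on the right are those whose right premise is valid; applying
  \<open>(\<box>)\<close> to precisely these leaves only the leftmost premise, which again has no fragment, and
  the search continues from there. Inside the finite set of subformulas it must repeat itself, and
  where it does a reflexive world realises the pair (\<open>pre_world_realizable\<close>).\<close>

section \<open>Tree models\<close>

datatype 'p model = World "'p set" bool "'p model list"

text \<open>Without the flag these would be models of Goedel-Loeb logic; worlds that see themselves are what
  the leftmost premise of the modal rule is about.\<close>

inductive sees :: "'p model \<Rightarrow> 'p model \<Rightarrow> bool" where
  self: "sees (World V True ms) (World V True ms)"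
| child: "m \<in> set ms \<Longrightarrow> sees (World V b ms) m"
| descendant: "m \<in> set ms \<Longrightarrow> sees m v \<Longrightarrow> sees (World V b ms) v"

lemma sees_World:
  "sees (World V b ms) v \<longleftrightarrow>
     (b \<and> v = World V b ms) \<or> (\<exists>m \<in> set ms. v = m \<or> sees m v)"
  by (subst sees.simps) auto

lemma sees_trans: "sees u v \<Longrightarrow> sees v w \<Longrightarrow> sees u w"
  by (induction rule: sees.induct) (auto intro: sees.intros)

lemma sees_size: "sees w v \<Longrightarrow> v = w \<or> size v < size w"
proof (induction rule: sees.induct)
  case (child m ms V b)
  then show ?case
    using size_list_estimation'[of m ms "size m" size] by auto
next
  case (descendant m ms v V b)
  then show ?case
    using size_list_estimation'[of m ms "size v" size] by fastforce
qed simp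

primrec sat :: "'p model \<Rightarrow> 'p fm \<Rightarrow> bool" where
  "sat w Bot \<longleftrightarrow> False"
| "sat w (Atom p) \<longleftrightarrow> (case w of World V b ms \<Rightarrow> p \<in> V)"
| "sat w (Imp A B) \<longleftrightarrow> (sat w A \<longrightarrow> sat w B)"
| "sat w (Box A) \<longleftrightarrow> (\<forall>v. sees w v \<longrightarrow> sat v A)"

fun refutes :: "'p model \<Rightarrow> 'p sequent \<Rightarrow> bool" where
  "refutes w (\<Gamma> \<turnstile> \<Delta>) \<longleftrightarrow> (\<forall>A \<in># \<Gamma>. sat w A) \<and> (\<forall>A \<in># \<Delta>. \<not> sat w A)"

definition valid :: "'p sequent \<Rightarrow> bool" where
  "valid s \<longleftrightarrow> (\<forall>w. \<not> refutes w s)"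

lemma sat_Box_sees: "sat w (Box A) \<Longrightarrow> sees w v \<Longrightarrow> sat v A \<and> sat v (Box A)"
  using sees_trans by auto

lemma set_mset_boxtimes: "set_mset (boxtimes \<Pi>) = set_mset \<Pi> \<union> Box ` set_mset \<Pi>"
  by (simp add: boxtimes_def boxes_def)

lemma in_boxtimes: "B \<in># boxtimes \<Pi> \<longleftrightarrow> B \<in># \<Pi> \<or> (\<exists>A. B = Box A \<and> A \<in># \<Pi>)"
  by (auto simp: boxtimes_def boxes_def)

section \<open>Soundness of the system with cut\<close>

text \<open>The world can stay where it is unless a right premise is refuted. The leftmost premise has to
  be used just when the only counterexamples to the boxed formulas are at \<open>w\<close> itself.\<close>

lemma box_rule_refutes:
  assumes "box_rule s ps" "refutes w s"
  shows "\<exists>j < length ps. \<exists>v. refutes v (ps ! j) \<and> (v = w \<and> j = 0 \<or> size v < size w)"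
  using assms
proof cases
  case (1 As \<Gamma> \<Pi> \<Delta>)
  have left: "sat v B" if "sees w v" "B \<in># boxtimes \<Pi>" for v B
  proof -
    from that(2) obtain A where A: "A \<in># \<Pi>" "B = A \<or> B = Box A"
      by (auto simp: in_boxtimes)
    then have "sat w (Box A)"
      using assms(2) unfolding 1 by (simp add: boxes_def del: sat.simps)
    then show ?thesis
      using sat_Box_sees[OF _ that(1)] A(2) by blast
  qed
  have right: "\<exists>v. sees w v \<and> \<not> sat v A" if "A \<in> set As" for A
  proof -
    have "\<not> sat w (Box A)"
      using assms(2) that unfolding 1 by (simp add: boxes_def del: sat.simps)
    then show ?thesis by auto
  qed
  show ?thesis
  proof (cases "\<exists>A \<in> set As. \<exists>v. sees w v \<and> \<not> sat v A \<and> v \<noteq> w")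
    case True
    then obtain i v where i: "i < length As" "sees w v" "\<not> sat v (As ! i)" "v \<noteq> w"
      by (metis in_set_conv_nth)
    then have "refutes v (ps ! Suc i)" "size v < size w" "Suc i < length ps"
      using left sees_size unfolding 1 by auto
    then show ?thesis by blast
  next
    case False
    then have A: "sees w w" "\<not> sat w A" if "A \<in> set As" for A
      using right that by metis+
    then have "sees w w" using \<open>As \<noteq> []\<close> by (cases As) auto
    then have "\<not> sat w B" if "B \<in># boxtimes (mset As)" for B
      using that A(2) unfolding in_boxtimes set_mset_mset by (metis sat.simps(4))
    then have "refutes w (ps ! 0)"
      using left[OF \<open>sees w w\<close>] unfolding 1 by simp
    moreover have "0 < length ps" unfolding 1 by simp
    ultimately show ?thesis by blast
  qed
qed

lemma Go_cut_rule_refutes: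
  assumes "Go_cut_rule s ps" "\<not> box_rule s ps" "refutes w s"
  shows "\<exists>j < length ps. refutes w (ps ! j)"
proof -
  have "\<exists>p \<in> set ps. refutes w p"
    using assms(1) by cases (use assms in \<open>auto elim!: Go_rule.cases\<close>)
  then show ?thesis by (metis in_set_conv_nth)
qed

lemma built_by_cut_refutes:
  assumes "built_by Go_cut_rule t" "refutes w (root t)"
  shows "\<exists>j v. j < length (subtrees t) \<and> refutes v (root (subtrees t ! j)) \<and>
    size v \<le> size w \<and> (right_premise t j \<longrightarrow> size v < size w)"
proof -
  let ?s = "root t" and ?ps = "map root (subtrees t)"
  have rule: "Go_cut_rule ?s ?ps"
    using assms(1) by cases
  show ?thesis
  proof (cases "box_rule ?s ?ps")
    case True
    obtain j v where "j < length ?ps" "refutes v (?ps ! j)" "v = w \<and> j = 0 \<or> size v < size w"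
      using box_rule_refutes[OF True assms(2)] by blast
    then show ?thesis
      by (intro exI[of _ j] exI[of _ v]) (auto simp: right_premise_def)
  next
    case False
    obtain j where "j < length ?ps" "refutes w (?ps ! j)"
      using Go_cut_rule_refutes[OF rule False assms(2)] by blast
    then show ?thesis
      using False by (intro exI[of _ j] exI[of _ w]) (auto simp: right_premise_def)
  qed
qed

lemma decreases_finitely_often:
  fixes f :: "nat \<Rightarrow> nat"
  assumes "\<And>i. f (Suc i) \<le> f i"
  shows "finite {i. f (Suc i) < f i}"
proof -
  obtain N where N: "\<And>i. f N \<le> f i"
    using ex_has_least_nat[of "\<lambda>_. True" undefined f] by auto
  have const: "f i = f N" if "N \<le> i" for i
    using N[of i] lift_Suc_antimono_le[of f, OF assms that] by simp
  have "{i. f (Suc i) < f i} \<subseteq> {..<N}"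
  proof
    fix i assume "i \<in> {i. f (Suc i) < f i}"
    then show "i \<in> {..<N}"
      using const[of i] const[of "Suc i"] by (cases "N \<le> i") auto
  qed
  then show ?thesis by (rule finite_subset) simp
qed

theorem provable_cut_valid:
  assumes "provable Go_cut_rule s"
  shows "valid s"
  unfolding valid_def
proof (intro allI notI)
  fix w assume w: "refutes w s"
  obtain t where t: "infinity_proof Go_cut_rule t" "root t = s"
    using assms by (auto simp: provable_def)
  \<comment> \<open>The state of the branch is a subtree together with a world that refutes its root.\<close>
  define ok where "ok x \<longleftrightarrow> built_by Go_cut_rule (fst x) \<and> refutes (snd x) (root (fst x))"
    for x :: "'a tree \<times> 'a model"
  define move where "move x j y \<longleftrightarrow> j < length (subtrees (fst x)) \<and> fst y = subtrees (fst x) ! j \<and>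
      size (snd y) \<le> size (snd x) \<and> (right_premise (fst x) j \<longrightarrow> size (snd y) < size (snd x))"
    for x y :: "'a tree \<times> 'a model" and j
  have step: "\<exists>y. ok y \<and> (\<exists>j. move x j y)" if "ok x" for x
  proof -
    obtain j v where j: "j < length (subtrees (fst x))" "refutes v (root (subtrees (fst x) ! j))"
      "size v \<le> size (snd x)" "right_premise (fst x) j \<longrightarrow> size v < size (snd x)"
      using built_by_cut_refutes[of "fst x" "snd x"] \<open>ok x\<close> unfolding ok_def by blast
    have "built_by Go_cut_rule (subtrees (fst x) ! j)"
      using that j(1) unfolding ok_def by (auto elim: built_by.cases)
    then show ?thesis
      using j by (intro exI[of _ "(subtrees (fst x) ! j, v)"]) (auto simp: ok_def move_def)
  qed
  have "ok (t, w)"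
    using t w by (simp add: ok_def infinity_proof_def)
  then obtain x where x: "x 0 = (t, w)" "\<And>i. \<exists>j. move (x i) j (x (Suc i))"
    using dependent_nat_choice[of "\<lambda>n z. ok z \<and> (n = 0 \<longrightarrow> z = (t, w))"
        "\<lambda>_ z y. \<exists>j. move z j y"] step by (metis nat.distinct(1))
  then obtain k where k: "\<And>i. move (x i) (k i) (x (Suc i))" by metis
  have "infinite_branch t (fst \<circ> x) k"
    using x(1) k by (auto simp: infinite_branch_def move_def)
  then have "infinite {i. right_premise (fst (x i)) (k i)}"
    using t(1) unfolding infinity_proof_def by fastforce
  moreover have "finite {i. size (snd (x (Suc i))) < size (snd (x i))}"
    by (rule decreases_finitely_often) (use k in \<open>auto simp: move_def\<close>)
  moreover have "{i. right_premise (fst (x i)) (k i)} \<subseteq> {i. size (snd (x (Suc i))) < size (snd (x i))}"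
    using k by (auto simp: move_def)
  ultimately show False
    using finite_subset by blast
qed

section \<open>Assembling infinite proofs\<close>

primcorec unfold_tree :: "('p sequent \<Rightarrow> 'p sequent list) \<Rightarrow> 'p sequent \<Rightarrow> 'p tree" where
  "unfold_tree f s = Node s (map (unfold_tree f) (f s))"

text \<open>A rank that drops at every premise except the right ones forces every infinite branch
  through infinitely many right premises.\<close>

lemma provable_by_rank:
  fixes rank :: "'p sequent \<Rightarrow> nat"
  assumes "s \<in> S"
    and rule: "\<And>s. s \<in> S \<Longrightarrow> \<exists>ps. R s ps \<and> (\<forall>i < length ps. ps ! i \<in> S \<and>
           (box_rule s ps \<and> 1 \<le> i \<or> rank (ps ! i) < rank s))"
  shows "provable R s"
proof -
  obtain f where f: "\<And>s. s \<in> S \<Longrightarrow> R s (f s)"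
    "\<And>s i. s \<in> S \<Longrightarrow> i < length (f s) \<Longrightarrow> f s ! i \<in> S"
    "\<And>s i. s \<in> S \<Longrightarrow> i < length (f s) \<Longrightarrow> box_rule s (f s) \<and> 1 \<le> i \<or> rank (f s ! i) < rank s"
    using rule by metis
  let ?T = "unfold_tree f"
  have roots: "map root (map ?T ss) = ss" for ss
    by (induction ss) auto
  have "built_by R (?T s)" if "s \<in> S" for s
    using that
  proof (coinduction arbitrary: s)
    case built_by
    have "u \<in> S" if "u \<in> set (f s)" for u
      using that f(2)[OF built_by] by (metis in_set_conv_nth)
    then show ?case
      using f(1)[OF built_by] roots[of "f s"] by auto
  qed
  moreover have "infinite {i. right_premise (b i) (k i)}"
    if "infinite_branch (?T s) b k" for b k
  proof
    assume "finite {i. right_premise (b i) (k i)}"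
    then obtain N where N: "\<And>i. N \<le> i \<Longrightarrow> \<not> right_premise (b i) (k i)"
      by (metis (mono_tags) finite_nat_set_iff_bounded mem_Collect_eq not_le)
    have b: "b 0 = ?T s" "\<And>i. k i < length (subtrees (b i))" "\<And>i. b (Suc i) = subtrees (b i) ! k i"
      using that by (auto simp: infinite_branch_def)
    have inv: "root (b i) \<in> S \<and> b i = ?T (root (b i))" for i
    proof (induction i)
      case (Suc i)
      then show ?case
        using b(2,3)[of i] f(2) by (metis length_map nth_map unfold_tree.sel)
    qed (use b(1) assms(1) in simp)
    have drop: "rank (root (b (Suc i))) < rank (root (b i))" if "N \<le> i" for i
    proof -
      obtain u where u: "root (b i) = u" "u \<in> S" "b i = ?T u" using inv by blast
      have "k i < length (f u)" "root (b (Suc i)) = f u ! k i"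
        using b(2,3)[of i] u(3) by auto
      then show ?thesis
        using N[OF that] f(3)[OF u(2)] u roots[of "f u"] by (auto simp: right_premise_def)
    qed
    have "finite {i. rank (root (b (Suc (N + i)))) < rank (root (b (N + i)))}"
      using decreases_finitely_often[of "\<lambda>i. rank (root (b (N + i)))"] drop
      by (simp add: less_imp_le)
    then show False
      using drop by simp
  qed
  ultimately show ?thesis
    using assms(1) unfolding provable_def infinity_proof_def by (metis unfold_tree.sel(1))
qed

section \<open>Fragments that stop at valid right premises\<close>

text \<open>The argument bounds the height of the fragment; it becomes the rank when fragments are put
  together.\<close>

primrec fragment :: "nat \<Rightarrow> 'p sequent \<Rightarrow> bool" where
  "fragment 0 s \<longleftrightarrow> False"
| "fragment (Suc n) s \<longleftrightarrow> (\<exists>ps. Go_rule s ps \<and> (\<forall>i < length ps.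
     box_rule s ps \<and> 1 \<le> i \<and> valid (ps ! i) \<or> fragment n (ps ! i)))"

lemma fragment_mono: "fragment n s \<Longrightarrow> n \<le> m \<Longrightarrow> fragment m s"
proof (induction n arbitrary: s m)
  case (Suc n)
  obtain m' where m: "m = Suc m'" "n \<le> m'"
    using Suc.prems(2) by (cases m) auto
  obtain ps where ps: "Go_rule s ps" "\<forall>i < length ps.
      box_rule s ps \<and> 1 \<le> i \<and> valid (ps ! i) \<or> fragment n (ps ! i)"
    using Suc.prems(1) unfolding fragment.simps by blast
  show ?case
    unfolding m(1) fragment.simps using ps Suc.IH[OF _ m(2)] by blast
qed simp

definition stuck :: "'p sequent \<Rightarrow> bool" where
  "stuck s \<longleftrightarrow> (\<forall>n. \<not> fragment n s)"

text \<open>A rule has finitely many premises, so that fragments for all of them that need one have a common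
  bound on their heights.\<close>

lemma stuck_premise:
  assumes "stuck s" "Go_rule s ps"
  shows "\<exists>i < length ps. stuck (ps ! i) \<and> \<not> (box_rule s ps \<and> 1 \<le> i \<and> valid (ps ! i))"
proof (rule ccontr)
  assume *: "\<not> ?thesis"
  then have "\<forall>i. \<exists>n. i < length ps \<longrightarrow> box_rule s ps \<and> 1 \<le> i \<and> valid (ps ! i) \<or> fragment n (ps ! i)"
    by (auto simp: stuck_def)
  then obtain h where h: "\<And>i. i < length ps \<Longrightarrow>
      box_rule s ps \<and> 1 \<le> i \<and> valid (ps ! i) \<or> fragment (h i) (ps ! i)"
    by metis
  have "h i \<le> (\<Sum>i < length ps. h i)" if "i < length ps" for i
    by (rule member_le_sum) (use that in auto)
  then have "fragment (Suc (\<Sum>i < length ps. h i)) s"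
    unfolding fragment.simps using h assms(2) fragment_mono by blast
  then show False
    using assms(1) unfolding stuck_def by blast
qed

text \<open>When a fragment ends at a valid right premise, that premise starts a new fragment. The least
  height may jump up there, but only there.\<close>

lemma provable_if_no_stuck_valid:
  assumes no_stuck: "\<And>s :: 'p sequent. valid s \<Longrightarrow> \<not> stuck s"
    and "valid (s :: 'p sequent)"
  shows "provable Go_rule s"
proof (rule provable_by_rank[where S = "{s. \<not> stuck s}" and rank = "\<lambda>s. LEAST n. fragment n s"])
  show "s \<in> {s. \<not> stuck s}" using assms by simp
  fix s :: "'p sequent"
  let ?rank = "\<lambda>s :: 'p sequent. LEAST n. fragment n s"
  assume "s \<in> {s. \<not> stuck s}"
  then have "fragment (?rank s) s"
    by (auto simp: stuck_def intro: LeastI)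
  then obtain n where n: "?rank s = Suc n" "fragment (Suc n) s"
    by (cases "?rank s") auto
  then obtain ps where ps: "Go_rule s ps" "\<And>i. i < length ps \<Longrightarrow>
     box_rule s ps \<and> 1 \<le> i \<and> valid (ps ! i) \<or> fragment n (ps ! i)"
    by auto
  have "?rank p < ?rank s" if "fragment n p" for p
    using that n(1) by (metis Least_le le_imp_less_Suc)
  then show "\<exists>ps. Go_rule s ps \<and> (\<forall>i < length ps. ps ! i \<in> {s. \<not> stuck s} \<and>
         (box_rule s ps \<and> 1 \<le> i \<or> ?rank (ps ! i) < ?rank s))"
    using ps no_stuck by (intro exI[of _ ps]) (auto simp: stuck_def; metis)
qed

section \<open>Saturation\<close>

definition saturated :: "'p fm set \<Rightarrow> 'p fm set \<Rightarrow> bool" where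
  "saturated L R \<longleftrightarrow> Bot \<notin> L \<and> (\<forall>p. \<not> (Atom p \<in> L \<and> Atom p \<in> R)) \<and>
     (\<forall>A B. Imp A B \<in> L \<longrightarrow> B \<in> L \<or> A \<in> R) \<and>
     (\<forall>A B. Imp A B \<in> R \<longrightarrow> A \<in> L \<and> B \<in> R)"

definition unboxed :: "'p fm set \<Rightarrow> 'p fm set" where
  "unboxed L = {A. Box A \<in> L}"

text \<open>Saturation takes care of implications, so conditions are needed only for boxed formulas. At a
  reflexive world their truth depends on the unboxed formula at the same world; the latter is smaller,
  so that induction on formulas does not become circular.\<close>

lemma saturated_World:
  assumes sat: "saturated L R"
    and left: "\<And>m A. m \<in> set ms \<Longrightarrow> A \<in> unboxed L \<Longrightarrow> sat m A \<and> sat m (Box A)"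
    and refl: "b \<Longrightarrow> unboxed L \<subseteq> L"
    and right: "\<And>A. A \<in> unboxed R \<Longrightarrow> b \<and> A \<in> R \<or> (\<exists>m \<in> set ms. \<not> sat m A)"
  defines "w \<equiv> World {p. Atom p \<in> L} b ms"
  shows "(A \<in> L \<longrightarrow> sat w A) \<and> (A \<in> R \<longrightarrow> \<not> sat w A)"
proof (induction A)
  case (Box A)
  have "sat v A" if "A \<in> unboxed L" "sees w v" for v
    using that left refl Box unfolding w_def sees_World by auto
  moreover have "\<exists>v. sees w v \<and> \<not> sat v A" if "A \<in> unboxed R"
    using right[OF that] Box unfolding w_def sees_World by auto
  ultimately show ?case by (auto simp: unboxed_def)
qed (use sat in \<open>auto simp: saturated_def w_def\<close>)

primrec subfms :: "'p fm \<Rightarrow> 'p fm set" where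
  "subfms Bot = {Bot}"
| "subfms (Atom p) = {Atom p}"
| "subfms (Imp A B) = insert (Imp A B) (subfms A \<union> subfms B)"
| "subfms (Box A) = insert (Box A) (subfms A)"

lemma finite_subfms: "finite (subfms A)"
  by (induction A) auto

lemma subfms_refl: "A \<in> subfms A"
  by (cases A) auto

lemma subfms_trans: "A \<in> subfms B \<Longrightarrow> subfms A \<subseteq> subfms B"
  by (induction B) auto

definition subfm_closed :: "'p fm set \<Rightarrow> bool" where
  "subfm_closed F \<longleftrightarrow> (\<forall>A \<in> F. subfms A \<subseteq> F)"

lemma subfm_closed_Imp: "subfm_closed F \<Longrightarrow> Imp A B \<in> F \<Longrightarrow> A \<in> F \<and> B \<in> F"
  using subfms_refl[of A] subfms_refl[of B] by (force simp: subfm_closed_def)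

lemma subfm_closed_Box: "subfm_closed F \<Longrightarrow> Box A \<in> F \<Longrightarrow> A \<in> F"
  using subfms_refl[of A] by (force simp: subfm_closed_def)

text \<open>A saturated pair reached by backward search, together with the stuck sequent at which the
  search ended. The implication rules consume their principal formulas, so that sequent retains only
  the atoms and boxed formulas of the pair; the boxed ones are what the next step needs.\<close>

definition pre_world :: "'p fm set \<Rightarrow> 'p fm set \<Rightarrow> bool" where
  "pre_world L R \<longleftrightarrow> saturated L R \<and>
     (\<exists>\<Gamma> \<Delta>. stuck (\<Gamma> \<turnstile> \<Delta>) \<and> Box ` unboxed L \<subseteq> set_mset \<Gamma> \<and> Box ` unboxed R \<subseteq> set_mset \<Delta>)"

lemma pre_world_insert_Imp_left:
  assumes "pre_world L R" "B \<in> L \<or> A \<in> R"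
  shows "pre_world (insert (Imp A B) L) R"
  using assms unfolding pre_world_def saturated_def unboxed_def by auto

lemma pre_world_insert_Imp_right:
  assumes "pre_world L R" "A \<in> L" "B \<in> R"
  shows "pre_world L (insert (Imp A B) R)"
  using assms unfolding pre_world_def saturated_def unboxed_def by auto

lemma stuck_not_initial:
  assumes "stuck (\<Gamma> \<turnstile> \<Delta>)"
  shows "Bot \<notin># \<Gamma>" "\<not> (Atom p \<in># \<Gamma> \<and> Atom p \<in># \<Delta>)"
proof -
  show "Bot \<notin># \<Gamma>"
  proof
    assume "Bot \<in># \<Gamma>"
    then obtain \<Gamma>' where "\<Gamma> = \<Gamma>' + {#Bot#}" by (metis add_mset_add_single mset_add)
    then show False using stuck_premise[OF assms, of "[]"] Go_rule.Init_Bot by auto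
  qed
  show "\<not> (Atom p \<in># \<Gamma> \<and> Atom p \<in># \<Delta>)"
  proof
    assume "Atom p \<in># \<Gamma> \<and> Atom p \<in># \<Delta>"
    then obtain \<Gamma>' \<Delta>' where "\<Gamma> = \<Gamma>' + {#Atom p#}" "\<Delta> = {#Atom p#} + \<Delta>'"
      by (metis add_mset_add_single mset_add union_commute)
    then show False using stuck_premise[OF assms, of "[]"] Go_rule.Init_Atom by fastforce
  qed
qed

text \<open>The implication rules strip a connective from their principal formula in each premise, so that
  backward search along stuck premises ends. Formulas met on the way are collected in the pair.\<close>

lemma saturation:
  assumes "stuck (\<Gamma> \<turnstile> \<Delta>)" "subfm_closed F" "set_mset \<Gamma> \<subseteq> F" "set_mset \<Delta> \<subseteq> F"
  shows "\<exists>L R. pre_world L R \<and> set_mset \<Gamma> \<subseteq> L \<and> L \<subseteq> F \<and> set_mset \<Delta> \<subseteq> R \<and> R \<subseteq> F"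
  using assms(1,3,4)
proof (induction "sum_mset (image_mset size \<Gamma>) + sum_mset (image_mset size \<Delta>)"
    arbitrary: \<Gamma> \<Delta> rule: less_induct)
  case less
  note stuck = less.prems(1) and F = less.prems(2,3)
  consider A B where "Imp A B \<in># \<Gamma>" | A B where "Imp A B \<in># \<Delta>"
    | "\<forall>A B. Imp A B \<notin># \<Gamma> \<and> Imp A B \<notin># \<Delta>" by blast
  then show ?case
  proof cases
    case (1 A B)
    then obtain \<Gamma>' where \<Gamma>: "\<Gamma> = \<Gamma>' + {#Imp A B#}" by (metis add_mset_add_single mset_add)
    have AB: "A \<in> F" "B \<in> F" "Imp A B \<in> F"
      using F subfm_closed_Imp[OF assms(2)] 1 by blast+
    have "stuck (\<Gamma>' + {#B#} \<turnstile> \<Delta>) \<or> stuck (\<Gamma>' \<turnstile> {#A#} + \<Delta>)"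
      using stuck_premise[OF stuck[unfolded \<Gamma>] Go_rule.Imp_L] by (auto simp: less_Suc_eq)
    then show ?thesis
    proof
      assume "stuck (\<Gamma>' + {#B#} \<turnstile> \<Delta>)"
      from less.hyps[OF _ this] obtain L R where "pre_world L R" "set_mset (\<Gamma>' + {#B#}) \<subseteq> L"
        "L \<subseteq> F" "set_mset \<Delta> \<subseteq> R" "R \<subseteq> F"
        using F AB \<Gamma> by auto
      then show ?thesis
        using pre_world_insert_Imp_left[of L R B A] AB \<Gamma>
        by (intro exI[of _ "insert (Imp A B) L"] exI[of _ R]) auto
    next
      assume "stuck (\<Gamma>' \<turnstile> {#A#} + \<Delta>)"
      from less.hyps[OF _ this] obtain L R where "pre_world L R" "set_mset \<Gamma>' \<subseteq> L"
        "L \<subseteq> F" "set_mset ({#A#} + \<Delta>) \<subseteq> R" "R \<subseteq> F"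
        using F AB \<Gamma> by auto
      then show ?thesis
        using pre_world_insert_Imp_left[of L R B A] AB \<Gamma>
        by (intro exI[of _ "insert (Imp A B) L"] exI[of _ R]) auto
    qed
  next
    case (2 A B)
    then obtain \<Delta>' where \<Delta>: "\<Delta> = {#Imp A B#} + \<Delta>'"
      by (metis add_mset_add_single mset_add union_commute)
    have AB: "A \<in> F" "B \<in> F" "Imp A B \<in> F"
      using F subfm_closed_Imp[OF assms(2)] 2 by blast+
    have "stuck (\<Gamma> + {#A#} \<turnstile> {#B#} + \<Delta>')"
      using stuck_premise[OF stuck[unfolded \<Delta>] Go_rule.Imp_R] by auto
    from less.hyps[OF _ this] obtain L R where "pre_world L R" "set_mset (\<Gamma> + {#A#}) \<subseteq> L"
        "L \<subseteq> F" "set_mset ({#B#} + \<Delta>') \<subseteq> R" "R \<subseteq> F"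
      using F AB \<Delta> by auto
    then show ?thesis
      using pre_world_insert_Imp_right[of L R A B] AB \<Delta>
      by (intro exI[of _ L] exI[of _ "insert (Imp A B) R"]) auto
  next
    case 3
    then have "saturated (set_mset \<Gamma>) (set_mset \<Delta>)"
      using stuck_not_initial[OF stuck] by (auto simp: saturated_def)
    then have "pre_world (set_mset \<Gamma>) (set_mset \<Delta>)"
      using stuck unfolding pre_world_def unboxed_def by blast
    then show ?thesis
      using F by blast
  qed
qed

section \<open>Realising saturated pairs\<close>

text \<open>The formulas on the right whose right premise cannot be refuted: no countermodel is at hand to
  put above the world, so that the modal rule has to be applied to them.\<close>

definition pending :: "'p fm set \<Rightarrow> 'p fm set \<Rightarrow> 'p fm set" where
  "pending L R = {A \<in> unboxed R. valid (boxtimes (mset_set (unboxed L)) \<turnstile> {#A#})}"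

lemma finite_unboxed: "finite L \<Longrightarrow> finite (unboxed L)"
  unfolding unboxed_def using finite_vimageI[of L Box] by (auto simp: vimage_def inj_def)

text \<open>Adding formulas on the left preserves validity, so a pending formula stays pending.\<close>

lemma pending_mono:
  assumes "unboxed L \<subseteq> unboxed L'" "finite L'" "pending L R \<subseteq> unboxed R'"
  shows "pending L R \<subseteq> pending L' R'"
proof -
  have fin: "finite (unboxed L)" "finite (unboxed L')"
    using assms(1) finite_unboxed[OF assms(2)] by (auto intro: finite_subset)
  have "set_mset (boxtimes (mset_set (unboxed L))) \<subseteq> set_mset (boxtimes (mset_set (unboxed L')))"
    using assms(1) fin unfolding set_mset_boxtimes by auto
  then have "valid (boxtimes (mset_set (unboxed L')) \<turnstile> \<Delta>)"
    if "valid (boxtimes (mset_set (unboxed L)) \<turnstile> \<Delta>)" for \<Delta>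
    using that unfolding valid_def refutes.simps by blast
  then show ?thesis
    using assms(3) unfolding pending_def by blast
qed

text \<open>All right premises of this application of the modal rule are valid, by the choice of the boxed
  formulas on the right; so only the leftmost premise can be to blame.\<close>

lemma pre_world_next:
  assumes "pre_world L R" "finite L" "finite R" "pending L R \<noteq> {}"
  shows "stuck (boxtimes (mset_set (unboxed L)) \<turnstile> boxtimes (mset_set (pending L R)))"
proof -
  obtain \<Gamma> \<Delta> where \<Gamma>\<Delta>: "stuck (\<Gamma> \<turnstile> \<Delta>)" "Box ` unboxed L \<subseteq> set_mset \<Gamma>"
    "Box ` unboxed R \<subseteq> set_mset \<Delta>"
    using assms(1) by (auto simp: pre_world_def)
  have fin: "finite (unboxed L)" "finite (pending L R)"
    using finite_unboxed[OF assms(2)] finite_unboxed[OF assms(3)] by (auto simp: pending_def)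
  obtain As where As: "set As = pending L R" "distinct As"
    using fin(2) finite_distinct_list by blast
  then have mset_As: "mset As = mset_set (pending L R)"
    by (metis mset_set_set)
  have sub: "boxes (mset_set X) \<subseteq># \<Theta>" if "Box ` X \<subseteq> set_mset \<Theta>" for X :: "'a fm set" and \<Theta>
  proof -
    have "boxes (mset_set X) = mset_set (Box ` X)"
      unfolding boxes_def by (rule image_mset_mset_set) (auto simp: inj_on_def)
    also have "\<dots> \<subseteq># \<Theta>"
      using that by (meson finite_set_mset mset_set_set_mset_msubset subset_imp_msubset_mset_set
        subset_mset.order_trans)
    finally show ?thesis .
  qed
  obtain \<Gamma>' where \<Gamma>': "\<Gamma> = \<Gamma>' + boxes (mset_set (unboxed L))"
    using sub[OF \<Gamma>\<Delta>(2)] by (metis subset_mset.diff_add)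
  have "Box ` pending L R \<subseteq> set_mset \<Delta>"
    using \<Gamma>\<Delta>(3) by (auto simp: pending_def)
  then obtain \<Delta>' where \<Delta>': "\<Delta> = boxes (mset As) + \<Delta>'"
    using sub mset_As by (metis subset_mset.add_diff_inverse)
  let ?L = "boxtimes (mset_set (unboxed L))"
  let ?ps = "(?L \<turnstile> boxtimes (mset As)) # map (\<lambda>A. ?L \<turnstile> {#A#}) As"
  have "As \<noteq> []" using As(1) assms(4) by auto
  then have box: "box_rule (\<Gamma> \<turnstile> \<Delta>) ?ps"
    unfolding \<Gamma>' \<Delta>' by (rule box_rule.intros)
  have "valid (?ps ! i)" if i: "1 \<le> i" "i < length ?ps" for i
  proof -
    obtain j where j: "i = Suc j" "j < length As" using i by (cases i) auto
    have "As ! j \<in> pending L R" using nth_mem[OF j(2)] by (simp only: As(1))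
    then have "valid (?L \<turnstile> {#As ! j#})" unfolding pending_def by blast
    then show ?thesis using j by simp
  qed
  then have "stuck (?ps ! 0)"
    using stuck_premise[OF \<Gamma>\<Delta>(1) Go_rule.Box_R[OF box]] box
    by (metis less_one linorder_not_le)
  then show ?thesis by (simp add: mset_As)
qed

text \<open>Countermodels of the right premises that are not valid, hung above the new world, make it refute
  the boxed formulas on the right that are not pending. Only the pending ones need further children
  \<open>ms\<close> or reflexivity.\<close>

lemma pre_world_realize_above:
  assumes "pre_world L R" "finite L" "finite R"
    and refl: "b \<Longrightarrow> unboxed L \<subseteq> L"
    and extra: "\<And>m A. m \<in> set ms \<Longrightarrow> A \<in> unboxed L \<Longrightarrow> sat m A \<and> sat m (Box A)"
    and pend: "\<And>A. A \<in> pending L R \<Longrightarrow> b \<and> A \<in> R \<or> (\<exists>m \<in> set ms. \<not> sat m A)"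
  shows "\<exists>w. \<forall>A. (A \<in> L \<longrightarrow> sat w A) \<and> (A \<in> R \<longrightarrow> \<not> sat w A)"
proof -
  let ?s = "\<lambda>A. boxtimes (mset_set (unboxed L)) \<turnstile> {#A#}"
  obtain g where g: "\<And>A. A \<in> unboxed R - pending L R \<Longrightarrow> refutes (g A) (?s A)"
  proof -
    have "\<forall>A \<in> unboxed R - pending L R. \<exists>w. refutes w (?s A)"
      by (auto simp: pending_def valid_def simp del: refutes.simps)
    then show thesis using that by metis
  qed
  obtain Bs where Bs: "set Bs = unboxed R - pending L R"
    using finite_list finite_unboxed[OF assms(3)] by (metis finite_Diff)
  have fin: "finite (unboxed L)"
    using assms(2) by (rule finite_unboxed)
  have gL: "sat (g B) A \<and> sat (g B) (Box A)" if "B \<in> set Bs" "A \<in> unboxed L" for A B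
  proof -
    have "A \<in># boxtimes (mset_set (unboxed L))" "Box A \<in># boxtimes (mset_set (unboxed L))"
      using that(2) fin by (auto simp: in_boxtimes)
    then show ?thesis using g that(1) Bs by (metis refutes.simps)
  qed
  have gR: "\<not> sat (g B) B" if "B \<in> set Bs" for B
    using g that Bs by auto
  have "saturated L R" using assms(1) by (simp add: pre_world_def)
  then show ?thesis
  proof (intro exI allI, rule saturated_World)
    show "sat m A \<and> sat m (Box A)" if "m \<in> set (ms @ map g Bs)" "A \<in> unboxed L" for m A
      using that extra gL by auto
    show "b \<and> A \<in> R \<or> (\<exists>m \<in> set (ms @ map g Bs). \<not> sat m A)" if "A \<in> unboxed R" for A
      using that pend[of A] gR[of A] Bs by (cases "A \<in> pending L R") auto
  qed (use refl in auto)
qed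

text \<open>The sets of boxed formulas on the left and of pending formulas can only grow along the search,
  so induction on the room left for them in \<open>F\<close> is possible. If neither grows, the next pair
  contains all these formulas without their boxes, which makes it realisable by a reflexive world.
  In either case the realisation of the next pair is put above an irreflexive world for the current
  one.\<close>

lemma pre_world_realizable:
  assumes F: "subfm_closed F" "finite F"
    and "pre_world L R" "L \<subseteq> F" "R \<subseteq> F"
  shows "\<exists>w. \<forall>A. (A \<in> L \<longrightarrow> sat w A) \<and> (A \<in> R \<longrightarrow> \<not> sat w A)"
  using assms(3-5)
proof (induction "card (F - unboxed L) + card (F - pending L R)" arbitrary: L R rule: less_induct)
  case less
  have fin: "finite L" "finite R"
    using less.prems F(2) finite_subset by blast+
  show ?case
  proof (cases "pending L R = {}")
    case True
    then show ?thesis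
      by (intro pre_world_realize_above[OF less.prems(1) fin, of False "[]"]) auto
  next
    case False
    have sub: "unboxed L \<subseteq> F" "pending L R \<subseteq> F"
      using less.prems subfm_closed_Box[OF F(1)] by (auto simp: unboxed_def pending_def)
    let ?\<Gamma> = "boxtimes (mset_set (unboxed L))" and ?\<Delta> = "boxtimes (mset_set (pending L R))"
    have finu: "finite (unboxed L)" "finite (pending L R)"
      using sub F(2) finite_subset by blast+
    then have \<Gamma>: "set_mset ?\<Gamma> = unboxed L \<union> Box ` unboxed L"
      and \<Delta>: "set_mset ?\<Delta> = pending L R \<union> Box ` pending L R"
      by (auto simp: in_boxtimes)
    have "set_mset ?\<Gamma> \<subseteq> F" "set_mset ?\<Delta> \<subseteq> F"
      unfolding \<Gamma> \<Delta> using sub less.prems by (auto simp: unboxed_def pending_def)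
    then obtain L' R' where L'R': "pre_world L' R'" "set_mset ?\<Gamma> \<subseteq> L'" "L' \<subseteq> F"
      "set_mset ?\<Delta> \<subseteq> R'" "R' \<subseteq> F"
      using saturation[OF pre_world_next[OF less.prems(1) fin False] F(1)] by blast
    have fin': "finite L'" "finite R'"
      using L'R' F(2) finite_subset by blast+
    have L_sub: "unboxed L \<subseteq> unboxed L'"
      using L'R'(2) unfolding \<Gamma> by (auto simp: unboxed_def)
    moreover have "pending L R \<subseteq> unboxed R'"
      using L'R'(4) unfolding \<Delta> by (auto simp: unboxed_def)
    ultimately have P_sub: "pending L R \<subseteq> pending L' R'"
      using pending_mono fin'(1) by blast
    have sub': "unboxed L' \<subseteq> F" "pending L' R' \<subseteq> F"
      using L'R' subfm_closed_Box[OF F(1)] by (auto simp: unboxed_def pending_def)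
    have "\<exists>w. \<forall>A. (A \<in> L' \<longrightarrow> sat w A) \<and> (A \<in> R' \<longrightarrow> \<not> sat w A)"
    proof (cases "unboxed L' = unboxed L \<and> pending L' R' = pending L R")
      case True
      \<comment> \<open>\<open>L'\<close> and \<open>R'\<close> contain the formulas in question because the leftmost premise has them unboxed, too.\<close>
      then show ?thesis
        using L'R'(2,4) unfolding \<Gamma> \<Delta>
        by (intro pre_world_realize_above[OF L'R'(1) fin', of True "[]"]) auto
    next
      case False
      have "card (F - unboxed L') \<le> card (F - unboxed L)"
        "card (F - pending L' R') \<le> card (F - pending L R)"
        using F(2) L_sub P_sub by (auto intro!: card_mono)
      moreover have "card (F - unboxed L') < card (F - unboxed L)" if "unboxed L' \<noteq> unboxed L"
        using F(2) L_sub that sub' by (intro psubset_card_mono) auto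
      moreover have "card (F - pending L' R') < card (F - pending L R)"
        if "pending L' R' \<noteq> pending L R"
        using F(2) P_sub that sub' by (intro psubset_card_mono) auto
      ultimately have "card (F - unboxed L') + card (F - pending L' R')
          < card (F - unboxed L) + card (F - pending L R)"
        using False by fastforce
      then show ?thesis
        using less.hyps L'R' by blast
    qed
    then obtain v where v: "\<And>A. A \<in> L' \<Longrightarrow> sat v A" "\<And>A. A \<in> R' \<Longrightarrow> \<not> sat v A" by blast
    show ?thesis
    proof (rule pre_world_realize_above[OF less.prems(1) fin, of False "[v]"])
      show "sat m A \<and> sat m (Box A)" if "m \<in> set [v]" "A \<in> unboxed L" for m A
        using that v(1)[of A] v(1)[of "Box A"] L'R'(2) unfolding \<Gamma> by auto
      show "False \<and> A \<in> R \<or> (\<exists>m \<in> set [v]. \<not> sat m A)" if "A \<in> pending L R" for A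
        using that v(2)[of A] L'R'(4) unfolding \<Delta> by auto
    qed simp
  qed
qed

section \<open>Completeness and cut admissibility\<close>

lemma stuck_not_valid:
  assumes "stuck s"
  shows "\<not> valid s"
proof -
  obtain \<Gamma> \<Delta> where s: "s = (\<Gamma> \<turnstile> \<Delta>)" by (cases s)
  define F where "F = (\<Union>A \<in> set_mset (\<Gamma> + \<Delta>). subfms A)"
  have F: "subfm_closed F" "finite F" "set_mset \<Gamma> \<subseteq> F" "set_mset \<Delta> \<subseteq> F"
    using subfms_trans subfms_refl finite_subfms by (fastforce simp: F_def subfm_closed_def)+
  obtain L R where LR: "pre_world L R" "set_mset \<Gamma> \<subseteq> L" "L \<subseteq> F" "set_mset \<Delta> \<subseteq> R" "R \<subseteq> F"
    using saturation[OF assms[unfolded s] F(1,3,4)] by blast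
  obtain w where "\<And>A. A \<in> L \<Longrightarrow> sat w A" "\<And>A. A \<in> R \<Longrightarrow> \<not> sat w A"
    using pre_world_realizable[OF F(1,2) LR(1,3,5)] by blast
  then have "refutes w s"
    using LR(2,4) by (auto simp: s)
  then show ?thesis by (auto simp: valid_def)
qed

theorem theorem6p6:
  fixes \<Gamma> \<Delta> :: "'p fm multiset"
  assumes "provable Go_cut_rule (\<Gamma> \<turnstile> \<Delta>)"
  shows "provable Go_rule (\<Gamma> \<turnstile> \<Delta>)"
  using provable_if_no_stuck_valid[OF _ provable_cut_valid[OF assms]] stuck_not_valid by blast

end
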